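(* Every scattered subset $A$ of an amenable group $G$ is absolute null, that is, $\mu(A)=0$ for each left invariant Banach measure $\mu$ on $G$.
   Context: A left invariant Banach measure on $G$ is a finitely additive probability measure $\mu$ defined on all subsets of $G$ with $\mu(gA)=\mu(A)$ for all $g\in G$, $A\subseteq G$. $G$ is regarded as a discrete group, $\beta G$ is the set of all ultrafilters on $G$, and $G^*$ is the set of free (non-principal) ultrafilters on $G$. For $Y\subseteq G$, $Y^*=\{p\in G^*: Y\in p\}$. For $g\in G$ and $p\in\beta G$, $gp=\{gP: P\in p\}$. For $p\in G^*$ and $Y\subseteq G$ put $\Delta_p(Y)=\{gp: g\in G,\ Y\in gp\}$. A subset $A$ of $G$ is scattered if for each infinite subset $Y$ of $A$ there is $p\in Y^*$ such that $\Delta_p(Y)$ is finite. A subset $A$ of an amenable group $G$ is absolute null if $\mu(A)=0$ for each left invariant Banach measure $\mu$ on $G$.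
   Formalization: The group G is additionally assumed to be infinite; for a finite group the statement fails, since A = G is vacuously scattered but has measure 1. *)

theory Defs
  imports Complex_Main "HOL-Algebra.Coset"
begin

definition left_invariant_Banach_measure :: "('a, 'b) monoid_scheme \<Rightarrow> ('a set \<Rightarrow> real) \<Rightarrow> bool" where
  "left_invariant_Banach_measure G \<mu> \<longleftrightarrow>
     (\<forall>A \<subseteq> carrier G. 0 \<le> \<mu> A) \<and>
     \<mu> (carrier G) = 1 \<and>
     (\<forall>A \<subseteq> carrier G. \<forall>B \<subseteq> carrier G. A \<inter> B = {} \<longrightarrow> \<mu> (A \<union> B) = \<mu> A + \<mu> B) \<and>
     (\<forall>g \<in> carrier G. \<forall>A \<subseteq> carrier G. \<mu> (g <#\<^bsub>G\<^esub> A) = \<mu> A)"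

definition amenable :: "('a, 'b) monoid_scheme \<Rightarrow> bool" where
  "amenable G \<longleftrightarrow> (\<exists>\<mu>. left_invariant_Banach_measure G \<mu>)"

definition ultrafilter_on :: "'a set \<Rightarrow> 'a set set \<Rightarrow> bool" where
  "ultrafilter_on X p \<longleftrightarrow>
     p \<subseteq> Pow X \<and> X \<in> p \<and> {} \<notin> p \<and>
     (\<forall>P \<in> p. \<forall>Q \<in> p. P \<inter> Q \<in> p) \<and>
     (\<forall>P \<in> p. \<forall>Q. P \<subseteq> Q \<and> Q \<subseteq> X \<longrightarrow> Q \<in> p) \<and>
     (\<forall>P \<subseteq> X. P \<in> p \<or> X - P \<in> p)"

definition principal_ultrafilter :: "'a set \<Rightarrow> 'a \<Rightarrow> 'a set set" where
  "principal_ultrafilter X x = {P. P \<subseteq> X \<and> x \<in> P}"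

definition free_ultrafilters :: "'a set \<Rightarrow> 'a set set set" where
  "free_ultrafilters X = {p. ultrafilter_on X p \<and> (\<forall>x \<in> X. p \<noteq> principal_ultrafilter X x)}"

(* Y* in the notation of the Stone-Cech remainder: the free ultrafilters on X that contain Y. *)
definition star :: "'a set \<Rightarrow> 'a set \<Rightarrow> 'a set set set" where
  "star X Y = {p \<in> free_ultrafilters X. Y \<in> p}"

definition ultra_translate :: "('a, 'b) monoid_scheme \<Rightarrow> 'a \<Rightarrow> 'a set set \<Rightarrow> 'a set set" where
  "ultra_translate G g p = (\<lambda>P. g <#\<^bsub>G\<^esub> P) ` p"

definition Delta :: "('a, 'b) monoid_scheme \<Rightarrow> 'a set set \<Rightarrow> 'a set \<Rightarrow> 'a set set set" where
  "Delta G p Y = {ultra_translate G g p | g. g \<in> carrier G \<and> Y \<in> ultra_translate G g p}"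

definition scattered :: "('a, 'b) monoid_scheme \<Rightarrow> 'a set \<Rightarrow> bool" where
  "scattered G A \<longleftrightarrow> A \<subseteq> carrier G \<and>
     (\<forall>Y \<subseteq> A. infinite Y \<longrightarrow> (\<exists>p \<in> star (carrier G) Y. finite (Delta G p Y)))"

definition absolute_null :: "('a, 'b) monoid_scheme \<Rightarrow> 'a set \<Rightarrow> bool" where
  "absolute_null G A \<longleftrightarrow> A \<subseteq> carrier G \<and>
     (\<forall>\<mu>. left_invariant_Banach_measure G \<mu> \<longrightarrow> \<mu> A = 0)"

end

theory Submission
  imports Defs
begin

text \<open>
  The contrapositive is proved: a set \<open>A\<close> charged by an invariant measure \<open>\<mu>\<close> contains an infinite
  \<open>Y\<close> such that \<open>\<Delta>\<^sub>p(Y)\<close> is infinite for every \<open>p \<in> Y\<^sup>*\<close>.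

  The measure enters only through recurrence (\<open>recurrence\<close>): if \<open>\<mu>(B) > 0\<close>, then
  \<open>\<mu>(B \<inter> s\<^sup>-\<^sup>1B) > 0\<close> for some \<open>s\<close> outside any prescribed finite set. Applied repeatedly, starting with
  \<open>A\<close>, it yields elements \<open>s\<^sub>0, s\<^sub>1, \<dots>\<close> whose cubes
  \<open>C\<^sub>n = {s\<^sub>0\<^bsup>e(0)\<^esup> \<dots> s\<^sub>n\<^sub>-\<^sub>1\<^bsup>e(n-1)\<^esup> : e(i) \<in> {0, 1}}\<close>
  have a right translate \<open>C\<^sub>n b\<^sub>n\<close> inside \<open>A\<close>; more precisely, the set of such \<open>b\<^sub>n\<close> has positive measure
  and so is infinite, and the \<open>b\<^sub>n\<close> can be taken distinct. Let \<open>Y\<close> be the union of the \<open>C\<^sub>n b\<^sub>n\<close>.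

  Switching the exponent \<open>e(k)\<close> of a point of \<open>C\<^sub>n b\<^sub>n\<close> with \<open>n > k\<close> keeps it in \<open>C\<^sub>n b\<^sub>n\<close>, and amounts to a left
  multiplication by a conjugate of \<open>s\<^sub>k\<close> or its inverse by one of the finitely many elements of \<open>C\<^sub>k\<close>.
  Let \<open>F\<^sub>k\<close> be the finite set of these multipliers. A free ultrafilter \<open>p\<close> containing \<open>Y\<close> ignores the
  finitely many points with \<open>n \<le> k\<close>, so it selects one \<open>g \<in> F\<^sub>k\<close> with \<open>g\<^sup>-\<^sup>1Y \<in> p\<close>. Since recurrence allows
  \<open>s\<^sub>k\<close> to avoid any finite set, the \<open>F\<^sub>k\<close> can be made pairwise disjoint, so infinitely many \<open>g\<close> arise. They
  give different ultrafilters \<open>gp\<close> because left translations act freely on ultrafilters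
  (\<open>ultra_translate_inj\<close>).
\<close>

section \<open>Ultrafilters and their translates\<close>

lemma ultrafilter_on_upward:
  "\<lbrakk>ultrafilter_on X p; P \<in> p; P \<subseteq> Q; Q \<subseteq> X\<rbrakk> \<Longrightarrow> Q \<in> p"
  by (simp add: ultrafilter_on_def)

lemma ultrafilter_on_subset: "\<lbrakk>ultrafilter_on X p; P \<in> p\<rbrakk> \<Longrightarrow> P \<subseteq> X"
  by (auto simp only: ultrafilter_on_def)

lemma ultrafilter_on_empty: "ultrafilter_on X p \<Longrightarrow> {} \<notin> p"
  by (simp add: ultrafilter_on_def)

lemma ultrafilter_on_carrier: "ultrafilter_on X p \<Longrightarrow> X \<in> p"
  by (simp add: ultrafilter_on_def)

lemma ultrafilter_on_compl:
  assumes "ultrafilter_on X p" "P \<subseteq> X" "P \<notin> p" shows "X - P \<in> p"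
proof -
  have "\<forall>P\<subseteq>X. P \<in> p \<or> X - P \<in> p"
    using assms(1) unfolding ultrafilter_on_def by (elim conjE)
  then show ?thesis using assms(2,3) by blast
qed

lemma ultrafilter_on_not_disjoint:
  assumes "ultrafilter_on X p" "P \<in> p" "Q \<in> p"
  shows "P \<inter> Q \<noteq> {}"
proof -
  have "P \<inter> Q \<in> p" using assms by (simp add: ultrafilter_on_def)
  then show ?thesis using ultrafilter_on_empty[OF assms(1)] by metis
qed

lemma ultrafilter_on_Un:
  assumes p: "ultrafilter_on X p" and "P \<union> Q \<in> p"
  shows "P \<in> p \<or> Q \<in> p"
proof (rule ccontr)
  assume neg: "\<not> (P \<in> p \<or> Q \<in> p)"
  have "P \<union> Q \<subseteq> X" by (rule ultrafilter_on_subset[OF assms])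
  then have "X - P \<in> p" "X - Q \<in> p"
    using ultrafilter_on_compl[OF p] neg by auto
  then have "(X - P) \<inter> (X - Q) \<in> p"
    using p by (simp add: ultrafilter_on_def)
  from ultrafilter_on_not_disjoint[OF p this assms(2)] show False by blast
qed

lemma ultrafilter_on_UN:
  assumes p: "ultrafilter_on X p" and "finite F" "(\<Union>g\<in>F. P g) \<in> p"
  shows "\<exists>g\<in>F. P g \<in> p"
  using assms(2,3)
proof (induction F)
  case empty
  then show ?case using ultrafilter_on_empty[OF p] by simp
next
  case (insert g F)
  have "P g \<union> (\<Union>g\<in>F. P g) \<in> p" using insert.prems by simp
  then show ?case using ultrafilter_on_Un[OF p] insert.IH by blast
qed

lemma free_ultrafilter_finite_notin:
  assumes "p \<in> free_ultrafilters X" "finite F"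
  shows "F \<notin> p"
proof
  assume "F \<in> p"
  have p: "ultrafilter_on X p" using assms by (simp add: free_ultrafilters_def)
  obtain x where x: "x \<in> F" "{x} \<in> p"
    using ultrafilter_on_UN[OF p \<open>finite F\<close>, of "\<lambda>x. {x}"] \<open>F \<in> p\<close> by auto
  then have "x \<in> X" using ultrafilter_on_subset[OF p \<open>F \<in> p\<close>] by blast
  have "p = principal_ultrafilter X x"
  proof (intro equalityI subsetI)
    fix P assume "P \<in> p"
    then have "P \<inter> {x} \<noteq> {}" "P \<subseteq> X"
      using ultrafilter_on_not_disjoint[OF p _ x(2)] ultrafilter_on_subset[OF p] by auto
    then show "P \<in> principal_ultrafilter X x" by (simp add: principal_ultrafilter_def)
  next
    fix P assume "P \<in> principal_ultrafilter X x"
    then show "P \<in> p"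
      using ultrafilter_on_upward[OF p x(2), of P] by (simp add: principal_ultrafilter_def)
  qed
  then show False using assms(1) \<open>x \<in> X\<close> unfolding free_ultrafilters_def by blast
qed

lemma (in group) mem_ultra_translate:
  assumes p: "ultrafilter_on (carrier G) p" and g: "g \<in> carrier G"
    and Y: "{x \<in> carrier G. g \<otimes> x \<in> Y} \<in> p" "Y \<subseteq> carrier G"
  shows "Y \<in> ultra_translate G g p"
proof -
  have "Y = g <# {x \<in> carrier G. g \<otimes> x \<in> Y}"
  proof (intro equalityI subsetI)
    fix y assume "y \<in> Y"
    then have "y \<in> carrier G" using Y by auto
    then have y: "g \<otimes> (inv g \<otimes> y) = y" using g by (simp add: m_assoc[symmetric])
    then have "inv g \<otimes> y \<in> {x \<in> carrier G. g \<otimes> x \<in> Y}"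
      using \<open>y \<in> Y\<close> \<open>y \<in> carrier G\<close> g by simp
    then show "y \<in> g <# {x \<in> carrier G. g \<otimes> x \<in> Y}" using y unfolding l_coset_def by force
  qed (auto simp: l_coset_def)
  then show ?thesis using Y unfolding ultra_translate_def by blast
qed

text \<open>
  A maximal \<open>P\<close> disjoint from \<open>kP\<close> satisfies \<open>G = P \<union> kP \<union> k\<^sup>-\<^sup>1P\<close>, since a point outside could be added
  to \<open>P\<close>. One of these three sets belongs to \<open>p\<close>, and each is disjoint from its \<open>k\<close>-translate.
\<close>

lemma (in group) ultrafilter_displaced_member:
  assumes p: "ultrafilter_on (carrier G) p" and k: "k \<in> carrier G" "k \<noteq> \<one>"
  shows "\<exists>Q\<in>p. \<forall>x\<in>Q. k \<otimes> x \<notin> Q"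
proof -
  define \<A> where "\<A> = {P. P \<subseteq> carrier G \<and> (\<forall>x\<in>P. k \<otimes> x \<notin> P)}"
  have "\<Union>\<C> \<in> \<A>" if "subset.chain \<A> \<C>" for \<C>
  proof -
    have sub: "\<C> \<subseteq> \<A>" and tot: "\<And>P Q. P \<in> \<C> \<Longrightarrow> Q \<in> \<C> \<Longrightarrow> P \<subseteq> Q \<or> Q \<subseteq> P"
      using that by (auto simp: subset_chain_def)
    have "k \<otimes> x \<notin> Q" if "x \<in> P" "P \<in> \<C>" "Q \<in> \<C>" for x P Q
      using tot[OF that(2,3)] that sub unfolding \<A>_def by blast
    then show ?thesis using sub unfolding \<A>_def by blast
  qed
  then obtain P where P: "P \<in> \<A>" and max: "\<And>Q. Q \<in> \<A> \<Longrightarrow> P \<subseteq> Q \<Longrightarrow> Q = P"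
    using subset_Zorn'[of \<A>] by metis
  have Pc: "P \<subseteq> carrier G" and Pk: "\<And>x. x \<in> P \<Longrightarrow> k \<otimes> x \<notin> P" using P by (auto simp: \<A>_def)
  define P1 where "P1 = {x \<in> carrier G. k \<otimes> x \<in> P}"
  define P2 where "P2 = {x \<in> carrier G. inv k \<otimes> x \<in> P}"
  have cover: "P \<union> (P1 \<union> P2) = carrier G"
  proof (intro equalityI subsetI)
    fix x assume x: "x \<in> carrier G"
    show "x \<in> P \<union> (P1 \<union> P2)"
    proof (rule ccontr)
      assume out: "x \<notin> P \<union> (P1 \<union> P2)"
      have "k \<otimes> x \<noteq> x" using k x by simp
      moreover have "k \<otimes> y \<noteq> x" if "y \<in> P" for y
      proof
        assume "k \<otimes> y = x"
        moreover have "inv k \<otimes> (k \<otimes> y) = y"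
          using that Pc k by (simp add: m_assoc[symmetric] subset_iff)
        ultimately have "inv k \<otimes> x = y" by simp
        then show False using out x that by (auto simp: P2_def)
      qed
      ultimately have "insert x P \<in> \<A>"
        using Pk Pc x out by (auto simp: \<A>_def P1_def)
      from max[OF this] out show False by auto
    qed
  qed (use Pc in \<open>auto simp: P1_def P2_def\<close>)
  have "k \<otimes> x \<notin> P1" if "x \<in> P1" for x using that Pk by (auto simp: P1_def)
  moreover have "k \<otimes> x \<notin> P2" if "x \<in> P2" for x
  proof
    assume "k \<otimes> x \<in> P2"
    then have "inv k \<otimes> (k \<otimes> x) \<in> P" "x \<in> carrier G" "inv k \<otimes> x \<in> P"
      using that by (auto simp: P2_def)
    moreover have "inv k \<otimes> (k \<otimes> x) = k \<otimes> (inv k \<otimes> x)"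
      using k \<open>x \<in> carrier G\<close> by (simp add: m_assoc[symmetric])
    ultimately show False using Pk[of "inv k \<otimes> x"] by auto
  qed
  moreover have "P \<in> p \<or> P1 \<in> p \<or> P2 \<in> p"
  proof -
    have "P \<union> (P1 \<union> P2) \<in> p" unfolding cover by (rule ultrafilter_on_carrier[OF p])
    then show ?thesis using ultrafilter_on_Un[OF p] by blast
  qed
  ultimately show ?thesis using Pk by blast
qed

lemma (in group) ultra_translate_inj:
  assumes p: "ultrafilter_on (carrier G) p" and gh: "g \<in> carrier G" "h \<in> carrier G"
    and eq: "ultra_translate G g p = ultra_translate G h p"
  shows "g = h"
proof (rule ccontr)
  assume "g \<noteq> h"
  then have "inv h \<otimes> g \<noteq> \<one>" using gh by (metis inv_closed inv_equality inv_inv)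
  then obtain Q where Q: "Q \<in> p" "\<And>x. x \<in> Q \<Longrightarrow> inv h \<otimes> g \<otimes> x \<notin> Q"
    using ultrafilter_displaced_member[OF p, of "inv h \<otimes> g"] gh by auto
  have "g <# Q \<in> ultra_translate G h p"
    using Q(1) eq unfolding ultra_translate_def by blast
  then obtain R where R: "R \<in> p" "g <# Q = h <# R" by (auto simp: ultra_translate_def)
  have car: "Q \<subseteq> carrier G" "R \<subseteq> carrier G"
    using ultrafilter_on_subset[OF p] Q(1) R(1) by blast+
  obtain r where r: "r \<in> Q" "r \<in> R" using ultrafilter_on_not_disjoint[OF p Q(1) R(1)] by blast
  then have "h \<otimes> r \<in> g <# Q" using R(2) by (auto simp: l_coset_def)
  then obtain q where q: "q \<in> Q" "h \<otimes> r = g \<otimes> q" by (auto simp: l_coset_def)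
  then have "r = inv h \<otimes> g \<otimes> q"
  proof -
    have "r \<in> carrier G" "q \<in> carrier G" using car r q(1) by auto
    then have "r = inv h \<otimes> (h \<otimes> r)" using gh by (simp add: m_assoc[symmetric])
    then show ?thesis using q(2) gh \<open>q \<in> carrier G\<close> by (simp add: m_assoc)
  qed
  then show False using Q(2) q(1) r(1) by auto
qed

section \<open>Recurrence for invariant measures\<close>

lemma (in group) measure_preimage:
  assumes M: "left_invariant_Banach_measure G \<mu>" and g: "g \<in> carrier G" and B: "B \<subseteq> carrier G"
  shows "\<mu> {x \<in> carrier G. g \<otimes> x \<in> B} = \<mu> B"
proof -
  have "{x \<in> carrier G. g \<otimes> x \<in> B} = inv g <# B"
  proof (intro equalityI subsetI)
    fix x assume "x \<in> {x \<in> carrier G. g \<otimes> x \<in> B}"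
    moreover from this have "x = inv g \<otimes> (g \<otimes> x)" using g by (simp add: m_assoc[symmetric])
    ultimately show "x \<in> inv g <# B" unfolding l_coset_def by blast
  next
    fix x assume "x \<in> inv g <# B"
    then obtain b where b: "b \<in> B" "x = inv g \<otimes> b" by (auto simp: l_coset_def)
    moreover have "g \<otimes> (inv g \<otimes> b) = b" using b B g by (auto simp: m_assoc[symmetric])
    ultimately show "x \<in> {x \<in> carrier G. g \<otimes> x \<in> B}" using B g by auto
  qed
  then show ?thesis using M g B unfolding left_invariant_Banach_measure_def by simp
qed

context
  fixes G :: "('a, 'b) monoid_scheme" (structure) and \<mu> :: "'a set \<Rightarrow> real"
  assumes M: "left_invariant_Banach_measure G \<mu>"
begin

lemma measure_nonneg: "A \<subseteq> carrier G \<Longrightarrow> 0 \<le> \<mu> A"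
  using M by (simp add: left_invariant_Banach_measure_def)

lemma measure_disjoint_Un:
  "\<lbrakk>A \<subseteq> carrier G; B \<subseteq> carrier G; A \<inter> B = {}\<rbrakk> \<Longrightarrow> \<mu> (A \<union> B) = \<mu> A + \<mu> B"
  using M by (simp add: left_invariant_Banach_measure_def)

lemma measure_empty: "\<mu> {} = 0"
  using measure_disjoint_Un[of "{}" "{}"] by simp

lemma measure_Diff_Int:
  assumes "A \<subseteq> carrier G" shows "\<mu> A = \<mu> (A - B) + \<mu> (A \<inter> B)"
proof -
  have "(A - B) \<union> (A \<inter> B) = A" "(A - B) \<inter> (A \<inter> B) = {}" by blast+
  then show ?thesis
    using measure_disjoint_Un[of "A - B" "A \<inter> B"] assms by fastforce
qed

lemma measure_mono:
  assumes "A \<subseteq> B" "B \<subseteq> carrier G" shows "\<mu> A \<le> \<mu> B"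
proof -
  have "B \<inter> A = A" using assms by blast
  then show ?thesis
    using measure_Diff_Int[OF assms(2), of A] measure_nonneg[of "B - A"] assms by auto
qed

lemma measure_UN_null:
  assumes "finite T" "\<And>t. t \<in> T \<Longrightarrow> N t \<subseteq> carrier G \<and> \<mu> (N t) = 0"
  shows "\<mu> (\<Union>t\<in>T. N t) = 0"
  using assms
proof (induction T)
  case empty
  then show ?case by (simp add: measure_empty)
next
  case (insert t T)
  let ?U = "\<Union>t\<in>T. N t"
  have sub: "?U \<subseteq> carrier G" "N t \<subseteq> carrier G" using insert.prems by auto
  have "\<mu> (?U \<union> (N t - ?U)) = \<mu> ?U + \<mu> (N t - ?U)"
    using sub by (intro measure_disjoint_Un) auto
  moreover have "\<mu> (N t - ?U) = 0"
  proof (rule antisym)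
    show "\<mu> (N t - ?U) \<le> 0"
      using measure_mono[of "N t - ?U" "N t"] sub(2) insert.prems by auto
    show "0 \<le> \<mu> (N t - ?U)" using sub(2) by (intro measure_nonneg) auto
  qed
  moreover have "?U \<union> (N t - ?U) = (\<Union>t\<in>insert t T. N t)" by auto
  ultimately show ?case using insert by auto
qed

text \<open>
  Otherwise the sets \<open>t\<^sup>-\<^sup>1B\<close> and \<open>g\<^sup>-\<^sup>1B\<close> meet in a null set whenever \<open>gt\<^sup>-\<^sup>1 \<notin> K\<close>. As \<open>G\<close> is infinite and
  \<open>K\<close> finite, arbitrarily many translates of \<open>B\<close> can be found that are pairwise almost disjoint, and
  their union would have measure above \<open>1\<close>.
\<close>

lemma recurrence:
  assumes G: "group G" "infinite (carrier G)" and B: "B \<subseteq> carrier G" "\<mu> B > 0"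
    and K: "finite K"
  shows "\<exists>s \<in> carrier G - K. \<mu> {x \<in> B. s \<otimes> x \<in> B} > 0"
proof (rule ccontr)
  assume neg: "\<not> ?thesis"
  interpret group G by fact
  define C where "C t = {x \<in> carrier G. t \<otimes> x \<in> B}" for t
  have null: "\<mu> {x \<in> B. s \<otimes> x \<in> B} = 0" if "s \<in> carrier G - K" for s
  proof -
    have "\<not> \<mu> {x \<in> B. s \<otimes> x \<in> B} > 0" using neg that by blast
    moreover have "{x \<in> B. s \<otimes> x \<in> B} \<subseteq> carrier G" using B by auto
    then have "0 \<le> \<mu> {x \<in> B. s \<otimes> x \<in> B}" by (rule measure_nonneg)
    ultimately show ?thesis by linarith
  qed
  have "\<exists>T. finite T \<and> T \<subseteq> carrier G \<and> \<mu> (\<Union>t\<in>T. C t) = real n * \<mu> B" for n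
  proof (induction n)
    case 0
    show ?case by (rule exI[of _ "{}"]) (simp add: measure_empty)
  next
    case (Suc n)
    then obtain T where T: "finite T" "T \<subseteq> carrier G" "\<mu> (\<Union>t\<in>T. C t) = real n * \<mu> B" by blast
    let ?U = "\<Union>t\<in>T. C t"
    have "finite ((\<lambda>(k, t). k \<otimes> t) ` (K \<times> T))" using K T by simp
    then have "infinite (carrier G - (\<lambda>(k, t). k \<otimes> t) ` (K \<times> T))"
      using G(2) by (rule Diff_infinite_finite)
    then obtain g where g: "g \<in> carrier G" "g \<notin> (\<lambda>(k, t). k \<otimes> t) ` (K \<times> T)"
      using infinite_imp_nonempty by blast
    have "C t \<inter> C g \<subseteq> carrier G \<and> \<mu> (C t \<inter> C g) = 0" if t: "t \<in> T" for t
    proof -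
      have tc: "t \<in> carrier G" using t T by auto
      have "g \<otimes> inv t \<notin> K"
      proof
        assume "g \<otimes> inv t \<in> K"
        moreover have "g = (g \<otimes> inv t) \<otimes> t" using g(1) tc by (simp add: m_assoc)
        ultimately have "g \<in> (\<lambda>(k, t). k \<otimes> t) ` (K \<times> T)"
          using t by (intro image_eqI[of _ _ "(g \<otimes> inv t, t)"]) auto
        then show False using g(2) by contradiction
      qed
      then have "\<mu> {x \<in> B. g \<otimes> inv t \<otimes> x \<in> B} = 0" using null g tc by simp
      moreover have "C t \<inter> C g = {x \<in> carrier G. t \<otimes> x \<in> {x \<in> B. g \<otimes> inv t \<otimes> x \<in> B}}"
      proof -
        have "g \<otimes> inv t \<otimes> (t \<otimes> x) = g \<otimes> x" if "x \<in> carrier G" for x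
        proof -
          have "inv t \<otimes> (t \<otimes> x) = x" using tc that by (simp add: m_assoc[symmetric])
          then show ?thesis using g tc that by (simp add: m_assoc)
        qed
        then show ?thesis by (auto simp: C_def)
      qed
      moreover have "\<mu> {x \<in> carrier G. t \<otimes> x \<in> {x \<in> B. g \<otimes> inv t \<otimes> x \<in> B}}
          = \<mu> {x \<in> B. g \<otimes> inv t \<otimes> x \<in> B}"
        using B by (intro measure_preimage[OF M tc]) auto
      ultimately show ?thesis by (auto simp: C_def)
    qed
    then have "\<mu> (\<Union>t\<in>T. C t \<inter> C g) = 0" by (rule measure_UN_null[OF T(1)])
    moreover have "(\<Union>t\<in>T. C t \<inter> C g) = C g \<inter> ?U" by blast
    moreover have "\<mu> (C g) = \<mu> B" unfolding C_def by (rule measure_preimage[OF M g(1) B(1)])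
    moreover have Cc: "C t \<subseteq> carrier G" for t by (auto simp: C_def)
    ultimately have "\<mu> (C g - ?U) = \<mu> B" using measure_Diff_Int[OF Cc, of g ?U] by simp
    moreover have "\<mu> (?U \<union> (C g - ?U)) = \<mu> ?U + \<mu> (C g - ?U)"
      using Cc by (intro measure_disjoint_Un) auto
    moreover have "?U \<union> (C g - ?U) = (\<Union>t\<in>insert g T. C t)" by auto
    ultimately have "\<mu> (\<Union>t\<in>insert g T. C t) = real (Suc n) * \<mu> B"
      using T(3) by (simp add: algebra_simps)
    then show ?case using T g by (intro exI[of _ "insert g T"]) auto
  qed
  moreover obtain n where "real n * \<mu> B > 1"
    using B(2) reals_Archimedean3[of "\<mu> B"] by blast
  moreover from calculation(1)[of n] obtain T where "\<mu> (\<Union>t\<in>T. C t) = real n * \<mu> B" by blast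
  ultimately have "\<mu> (\<Union>t\<in>T. C t) > 1" by simp
  moreover have "\<mu> (\<Union>t\<in>T. C t) \<le> \<mu> (carrier G)" by (rule measure_mono) (auto simp: C_def)
  moreover have "\<mu> (carrier G) = 1" using M by (simp add: left_invariant_Banach_measure_def)
  ultimately show False by linarith
qed

text \<open>If \<open>B\<close> were finite, recurrence could be made to avoid the finitely many quotients \<open>b'b\<^sup>-\<^sup>1\<close>.\<close>

lemma positive_measure_infinite:
  assumes G: "group G" "infinite (carrier G)" and B: "B \<subseteq> carrier G" "\<mu> B > 0"
  shows "infinite B"
proof
  interpret group G by fact
  assume "finite B"
  then have "finite ((\<lambda>(b, b'). b' \<otimes> inv b) ` (B \<times> B))" by simp
  from recurrence[OF G B this] obtain s where s: "s \<in> carrier G"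
    "s \<notin> (\<lambda>(b, b'). b' \<otimes> inv b) ` (B \<times> B)" "\<mu> {x \<in> B. s \<otimes> x \<in> B} > 0" by blast
  have "{x \<in> B. s \<otimes> x \<in> B} \<noteq> {}" using s(3) measure_empty by (metis less_irrefl)
  then obtain x where x: "x \<in> B" "s \<otimes> x \<in> B" by blast
  then have "s \<otimes> x \<otimes> inv x = s" using B(1) s(1) by (simp add: m_assoc subset_iff)
  then have "s \<in> (\<lambda>(b, b'). b' \<otimes> inv b) ` (B \<times> B)"
    using x by (intro image_eqI[of _ _ "(x, s \<otimes> x)"]) auto
  then show False using s(2) by contradiction
qed

end

section \<open>Cubes inside a set of positive measure\<close>

text \<open>
  \<open>C\<^sub>n\<close> is the cube spanned by \<open>s\<^sub>0, \<dots>, s\<^sub>n\<^sub>-\<^sub>1\<close>, and \<open>K\<^sub>k\<^sub>+\<^sub>1 - K\<^sub>k\<close> contains the multipliers that switch the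
  \<open>k\<close>-th exponent. The last conclusion survives the passage from \<open>C\<^sub>n\<close> to \<open>C\<^sub>n \<union> C\<^sub>n s\<^sub>n\<close> because left and
  right multiplications commute. Passing to \<open>C\<^sub>n \<union> C\<^sub>n s\<^sub>n\<close> replaces the set \<open>B\<close> of admissible base points
  by \<open>B \<inter> s\<^sub>n\<^sup>-\<^sup>1B\<close>, which is the set that recurrence provides.
\<close>

lemma cubes_in_positive_measure:
  fixes G (structure) and A :: "'a set"
  assumes M: "left_invariant_Banach_measure G \<mu>" and G: "group G" "infinite (carrier G)"
    and A: "A \<subseteq> carrier G" "\<mu> A > 0"
  shows "\<exists>C K :: nat \<Rightarrow> 'a set.
    (\<forall>n. finite (C n) \<and> C n \<subseteq> carrier G \<and> \<one> \<in> C n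
       \<and> infinite {x \<in> carrier G. \<forall>c\<in>C n. c \<otimes> x \<in> A})
    \<and> (\<forall>k. finite (K k) \<and> K k \<subseteq> carrier G \<and> K k \<subseteq> K (Suc k))
    \<and> (\<forall>k n. k < n \<longrightarrow> (\<forall>c\<in>C n. \<exists>g \<in> K (Suc k) - K k. g \<otimes> c \<in> C n))"
proof -
  interpret group G by fact
  define base where "base D = {x \<in> carrier G. \<forall>c\<in>D. c \<otimes> x \<in> A}" for D
  define ok where "ok = (\<lambda>(D, L). finite D \<and> D \<subseteq> carrier G \<and> \<one> \<in> D \<and> finite L
      \<and> L \<subseteq> carrier G \<and> \<mu> (base D) > 0)"
  define step where "step = (\<lambda>(D, L) (D', L'). L \<subseteq> L' \<and>
      (\<exists>s\<in>carrier G. D' = D \<union> (\<lambda>c. c \<otimes> s) ` D) \<and> (\<forall>c\<in>D'. \<exists>g\<in>L' - L. g \<otimes> c \<in> D'))"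
  have ex_step: "\<exists>y. ok y \<and> step x y" if "ok x" for x
  proof -
    obtain D L where x: "x = (D, L)" by (cases x)
    have D: "finite D" "D \<subseteq> carrier G" "\<one> \<in> D" "\<mu> (base D) > 0"
      and L: "finite L" "L \<subseteq> carrier G" using that by (auto simp: ok_def x)
    have Dc: "c \<in> carrier G" if "c \<in> D" for c using that D by auto
    have Lc: "c \<in> carrier G" if "c \<in> L" for c using that L by auto
    \<comment> \<open>\<open>s\<close> avoids the conjugates of \<open>L\<close> and of its inverses, so its own conjugates avoid \<open>L\<close>.\<close>
    define Z where "Z = (\<lambda>(u, l). inv u \<otimes> l \<otimes> u) ` (D \<times> L)
      \<union> (\<lambda>(u, l). inv (inv u \<otimes> l \<otimes> u)) ` (D \<times> L)"
    have "finite Z" using D L by (simp add: Z_def)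
    moreover have "base D \<subseteq> carrier G" by (auto simp: base_def)
    ultimately obtain s where s: "s \<in> carrier G" "s \<notin> Z"
      "\<mu> {x \<in> base D. s \<otimes> x \<in> base D} > 0"
      using recurrence[OF M G _ D(4), of Z] by blast
    define D' where "D' = D \<union> (\<lambda>c. c \<otimes> s) ` D"
    define F where "F = (\<lambda>u. u \<otimes> s \<otimes> inv u) ` D \<union> (\<lambda>u. u \<otimes> inv s \<otimes> inv u) ` D"
    have "base D' = {x \<in> base D. s \<otimes> x \<in> base D}"
    proof -
      have "(c \<otimes> s) \<otimes> x = c \<otimes> (s \<otimes> x)" if "c \<in> D" "x \<in> carrier G" for c x
        using that Dc s by (simp add: m_assoc)
      then show ?thesis using s by (auto simp: base_def D'_def ball_Un)
    qed
    then have "ok (D', L \<union> F)"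
      using D L s by (auto simp: ok_def D'_def F_def Dc)
    moreover have "F \<inter> L = {}"
    proof -
      have conj_back: "inv u \<otimes> (u \<otimes> t \<otimes> inv u) \<otimes> u = t"
        if "u \<in> carrier G" "t \<in> carrier G" for u t
      proof -
        have "inv u \<otimes> (u \<otimes> t \<otimes> inv u) \<otimes> u = (inv u \<otimes> u) \<otimes> t \<otimes> (inv u \<otimes> u)"
          using that by (simp only: m_assoc inv_closed m_closed)
        then show ?thesis using that by simp
      qed
      have "u \<otimes> s \<otimes> inv u \<notin> L" if "u \<in> D" for u
      proof
        assume "u \<otimes> s \<otimes> inv u \<in> L"
        then have "inv u \<otimes> (u \<otimes> s \<otimes> inv u) \<otimes> u \<in> Z" using that unfolding Z_def by force
        then show False using conj_back[OF Dc[OF that] s(1)] s(2) by simp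
      qed
      moreover have "u \<otimes> inv s \<otimes> inv u \<notin> L" if "u \<in> D" for u
      proof
        assume "u \<otimes> inv s \<otimes> inv u \<in> L"
        then have "inv (inv u \<otimes> (u \<otimes> inv s \<otimes> inv u) \<otimes> u) \<in> Z"
          using that unfolding Z_def by force
        then show False using conj_back[OF Dc[OF that], of "inv s"] s by simp
      qed
      ultimately show ?thesis by (auto simp: F_def)
    qed
    moreover have "\<exists>g\<in>F. g \<otimes> c \<in> D'" if c: "c \<in> D'" for c
    proof -
      from c consider "c \<in> D" | u where "u \<in> D" "c = u \<otimes> s" by (auto simp: D'_def)
      then show ?thesis
      proof cases
        case 1
        then have "(c \<otimes> s \<otimes> inv c) \<otimes> c = c \<otimes> s" using Dc s by (simp add: m_assoc)
        then show ?thesis using 1 by (intro bexI[of _ "c \<otimes> s \<otimes> inv c"]) (auto simp: D'_def F_def)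
      next
        case 2
        have "(u \<otimes> inv s \<otimes> inv u) \<otimes> c = u \<otimes> inv s \<otimes> ((inv u \<otimes> u) \<otimes> s)"
          using 2 Dc s by (simp only: m_assoc inv_closed m_closed)
        also have "\<dots> = u" using 2 Dc s by (simp add: m_assoc)
        finally show ?thesis
          using 2 by (intro bexI[of _ "u \<otimes> inv s \<otimes> inv u"]) (auto simp: D'_def F_def)
      qed
    qed
    moreover have "L \<union> F - L = F" using \<open>F \<inter> L = {}\<close> by blast
    ultimately have "ok (D', L \<union> F) \<and> step x (D', L \<union> F)"
      using s(1) D'_def by (auto simp add: step_def x simp del: Un_iff)
    then show ?thesis by blast
  qed
  have "base {\<one>} = A" using A by (auto simp: base_def)
  then have "ok ({\<one>}, {})" using A by (simp add: ok_def)
  then obtain f where f: "\<And>n. ok (f n)" "\<And>n. step (f n) (f (Suc n))"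
    using dependent_nat_choice[of "\<lambda>_. ok" "\<lambda>_. step"] ex_step by metis
  define C where "C n = fst (f n)" for n
  define K where "K n = snd (f n)" for n
  have fn: "f n = (C n, K n)" for n by (simp add: C_def K_def)
  have C: "finite (C n)" "C n \<subseteq> carrier G" "\<one> \<in> C n" "\<mu> (base (C n)) > 0"
    and K: "finite (K n)" "K n \<subseteq> carrier G" for n
    using f(1)[of n] by (auto simp: ok_def fn)
  have KS: "K n \<subseteq> K (Suc n)"
    and CS: "\<exists>s\<in>carrier G. C (Suc n) = C n \<union> (\<lambda>c. c \<otimes> s) ` C n"
    and new: "\<forall>c\<in>C (Suc n). \<exists>g\<in>K (Suc n) - K n. g \<otimes> c \<in> C (Suc n)" for n
    using f(2)[of n] by (auto simp: step_def fn)
  \<comment> \<open>A multiplier available at stage \<open>k + 1\<close> remains available, since \<open>g(us) = (gu)s\<close>.\<close>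
  have "\<forall>c\<in>C n. \<exists>g\<in>K (Suc k) - K k. g \<otimes> c \<in> C n" if "Suc k \<le> n" for k n
    using that
  proof (induction n rule: dec_induct)
    case base
    show ?case by (rule new)
  next
    case (step n)
    obtain s where s: "s \<in> carrier G" "C (Suc n) = C n \<union> (\<lambda>c. c \<otimes> s) ` C n" using CS by blast
    show ?case
    proof
      fix c assume "c \<in> C (Suc n)"
      then consider "c \<in> C n" | u where "u \<in> C n" "c = u \<otimes> s" using s by auto
      then show "\<exists>g\<in>K (Suc k) - K k. g \<otimes> c \<in> C (Suc n)"
      proof cases
        case 1
        then show ?thesis using step.IH s(2) by blast
      next
        case 2
        then obtain g where g: "g \<in> K (Suc k) - K k" "g \<otimes> u \<in> C n" using step.IH by blast
        then have "g \<otimes> c = (g \<otimes> u) \<otimes> s" using 2 K C s by (auto simp: m_assoc subset_iff)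
        then show ?thesis using g s(2) by auto
      qed
    qed
  qed
  moreover have "infinite (base (C n))" for n
    using positive_measure_infinite[OF M G _ C(4)] by (auto simp: base_def)
  ultimately show ?thesis
    using C(1-3) K KS unfolding base_def by (intro exI[of _ C] exI[of _ K]) (simp add: Suc_le_eq)
qed

lemma inj_choice_from_infinite_sets:
  fixes S :: "nat \<Rightarrow> 'a set"
  assumes "\<And>n. infinite (S n)"
  shows "\<exists>b. inj b \<and> (\<forall>n. b n \<in> S n)"
proof -
  have "\<exists>b. \<forall>n. b n \<in> S n \<and> b n \<notin> b ` {..<n}"
  proof (rule dependent_wellorder_choice)
    fix n and f :: "nat \<Rightarrow> 'a"
    have "infinite (S n - f ` {..<n})" using assms by (simp add: Diff_infinite_finite)
    then show "\<exists>r. r \<in> S n \<and> r \<notin> f ` {..<n}" using infinite_imp_nonempty by blast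
  qed auto
  then obtain b where b: "\<And>n. b n \<in> S n" "\<And>n. b n \<notin> b ` {..<n}" by blast
  have "inj b"
  proof (rule linorder_injI)
    fix i j :: nat assume "i < j"
    then have "b i \<in> b ` {..<j}" by simp
    then show "b i \<noteq> b j" using b(2)[of j] by metis
  qed
  then show ?thesis using b(1) by blast
qed

section \<open>Scattered sets are absolute null\<close>

text \<open>
  A free ultrafilter on the union \<open>Y\<close> of the cubes \<open>C\<^sub>n b\<^sub>n\<close> sees only the cubes with \<open>n > k\<close>, for every
  \<open>k\<close>. Each point of these is moved inside \<open>Y\<close> by one of the finitely many multipliers in
  \<open>K\<^sub>k\<^sub>+\<^sub>1 - K\<^sub>k\<close>, so the ultrafilter chooses one that works for almost all points. Different \<open>k\<close> give
  different multipliers.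
\<close>

lemma positive_measure_imp_not_scattered:
  fixes G (structure)
  assumes M: "left_invariant_Banach_measure G \<mu>" and G: "group G" "infinite (carrier G)"
    and A: "A \<subseteq> carrier G" "\<mu> A > 0"
  shows "\<exists>Y\<subseteq>A. infinite Y \<and> (\<forall>p\<in>star (carrier G) Y. infinite (Delta G p Y))"
proof -
  interpret group G by fact
  obtain C K where
    hC: "\<forall>n. finite (C n) \<and> C n \<subseteq> carrier G \<and> \<one> \<in> C n
       \<and> infinite {x \<in> carrier G. \<forall>c\<in>C n. c \<otimes> x \<in> A}"
    and hK: "\<forall>k. finite (K k) \<and> K k \<subseteq> carrier G \<and> K k \<subseteq> K (Suc k)"
    and switch: "\<forall>k n. k < n \<longrightarrow> (\<forall>c\<in>C n. \<exists>g \<in> K (Suc k) - K k. g \<otimes> c \<in> C n)"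
    using cubes_in_positive_measure[OF M G A] by (elim exE conjE) (rule that)
  have C: "finite (C n)" "C n \<subseteq> carrier G" "\<one> \<in> C n"
    "infinite {x \<in> carrier G. \<forall>c\<in>C n. c \<otimes> x \<in> A}" for n using hC by simp_all
  have K: "finite (K k)" "K k \<subseteq> carrier G" "K k \<subseteq> K (Suc k)" for k using hK by simp_all
  obtain b where "inj b" and "\<forall>n. b n \<in> {x \<in> carrier G. \<forall>c\<in>C n. c \<otimes> x \<in> A}"
    using inj_choice_from_infinite_sets[of "\<lambda>n. {x \<in> carrier G. \<forall>c\<in>C n. c \<otimes> x \<in> A}", OF C(4)]
    by (elim exE conjE) (rule that)
  then have b: "inj b" "\<And>n. b n \<in> carrier G" "\<And>n c. c \<in> C n \<Longrightarrow> c \<otimes> b n \<in> A" by simp_all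
  define Y where "Y = (\<Union>n. (\<lambda>c. c \<otimes> b n) ` C n)"
  have YA: "Y \<subseteq> A" using b(3) by (auto simp: Y_def)
  have "b n \<in> Y" for n
  proof -
    have "\<one> \<otimes> b n \<in> Y" using C(3)[of n] unfolding Y_def by blast
    then show ?thesis using b(2)[of n] by simp
  qed
  then have "range b \<subseteq> Y" by blast
  then have "infinite Y" using b(1) infinite_iff_countable_subset by blast
  moreover have "infinite (Delta G p Y)" if p: "p \<in> star (carrier G) Y" for p
  proof -
    have free: "p \<in> free_ultrafilters (carrier G)" and Yp: "Y \<in> p"
      using p by (auto simp: star_def)
    then have u: "ultrafilter_on (carrier G) p" by (simp add: free_ultrafilters_def)
    have "\<forall>k. \<exists>g. g \<in> K (Suc k) - K k \<and> Y \<in> ultra_translate G g p"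
    proof
      fix k
      let ?pre = "\<lambda>g. {x \<in> carrier G. g \<otimes> x \<in> Y}"
      \<comment> \<open>The finitely many points whose cube may have no \<open>k\<close>-th exponent to switch.\<close>
      define E where "E = (\<Union>n\<le>k. (\<lambda>c. c \<otimes> b n) ` C n)"
      have "Y \<subseteq> E \<union> (\<Union>g\<in>K (Suc k) - K k. ?pre g)"
      proof
        fix y assume "y \<in> Y"
        then obtain n c where y: "c \<in> C n" "y = c \<otimes> b n" by (auto simp: Y_def)
        show "y \<in> E \<union> (\<Union>g\<in>K (Suc k) - K k. ?pre g)"
        proof (cases "n \<le> k")
          case True
          then show ?thesis using y by (auto simp: E_def)
        next
          case False
          then obtain g where g: "g \<in> K (Suc k) - K k" "g \<otimes> c \<in> C n"
            using switch[rule_format, of k n c] y by auto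
          then have "g \<otimes> y = (g \<otimes> c) \<otimes> b n"
            using y C(2) K(2) b(2) by (auto simp: m_assoc subset_iff)
          then have "g \<otimes> y \<in> Y" using g by (auto simp: Y_def)
          moreover have "y \<in> carrier G" using \<open>y \<in> Y\<close> YA A by auto
          ultimately show ?thesis using g(1) by blast
        qed
      qed
      moreover have "E \<subseteq> carrier G" using b(3) A by (auto simp: E_def)
      ultimately have "E \<union> (\<Union>g\<in>K (Suc k) - K k. ?pre g) \<in> p"
        by (intro ultrafilter_on_upward[OF u Yp]) auto
      moreover have "E \<notin> p"
        using C(1) by (intro free_ultrafilter_finite_notin[OF free]) (auto simp: E_def)
      ultimately have "(\<Union>g\<in>K (Suc k) - K k. ?pre g) \<in> p"
        by (metis (no_types, lifting) ultrafilter_on_Un[OF u])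
      from ultrafilter_on_UN[OF u finite_Diff[OF K(1)] this]
      obtain g where g: "g \<in> K (Suc k) - K k" "?pre g \<in> p" by (rule bexE)
      then have "g \<in> carrier G" using K(2) by auto
      then have "Y \<in> ultra_translate G g p"
        using YA A g(2) by (intro mem_ultra_translate[OF u]) auto
      then show "\<exists>g. g \<in> K (Suc k) - K k \<and> Y \<in> ultra_translate G g p"
        using g(1) by (intro exI conjI)
    qed
    from choice[OF this] obtain g where
      "\<forall>k. g k \<in> K (Suc k) - K k \<and> Y \<in> ultra_translate G (g k) p" by (rule exE)
    then have g: "g k \<in> K (Suc k) - K k" "Y \<in> ultra_translate G (g k) p" for k by simp_all
    have "inj g"
    proof (rule linorder_injI)
      fix i j :: nat assume "i < j"
      then have "K (Suc i) \<subseteq> K j" using lift_Suc_mono_le[of K "Suc i" j, OF K(3)] by simp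
      then show "g i \<noteq> g j" using g(1)[of i] g(1)[of j] by auto
    qed
    have gc: "g k \<in> carrier G" for k using g(1)[of k] K(2)[of "Suc k"] by auto
    have "inj (\<lambda>k. ultra_translate G (g k) p)"
      using ultra_translate_inj[OF u gc gc] injD[OF \<open>inj g\<close>] by (intro injI) simp
    moreover have "range (\<lambda>k. ultra_translate G (g k) p) \<subseteq> Delta G p Y"
      using g(2) gc by (auto simp: Delta_def)
    ultimately show ?thesis unfolding infinite_iff_countable_subset by blast
  qed
  ultimately show ?thesis using YA by blast
qed

theorem theorem2:
  fixes G :: "('a, 'b) monoid_scheme" and A :: "'a set"
  assumes "group G" and "infinite (carrier G)" and "amenable G"
    and "scattered G A"
  shows "absolute_null G A"
proof -
  have A: "A \<subseteq> carrier G" using assms(4) by (simp add: scattered_def)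
  have "\<mu> A = 0" if M: "left_invariant_Banach_measure G \<mu>" for \<mu>
  proof (rule ccontr)
    assume "\<mu> A \<noteq> 0"
    then have "\<mu> A > 0" using measure_nonneg[OF M A] by simp
    from positive_measure_imp_not_scattered[OF M assms(1,2) A this] show False
      using assms(4) unfolding scattered_def by blast
  qed
  then show ?thesis using A by (simp add: absolute_null_def)
qed

end
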